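(* Let $1<q<p$, let $(X,\mu)$ be a non-atomic probability space, let $\mathcal{T}$ be a tree on $X$, and let $\phi\in L^p(X,\mu)$ with $\phi\ge 0$, $\int_X\phi\,d\mu=f>0$, $\int_X\phi^q\,d\mu=A$ and $\int_X\phi^p\,d\mu=F$. Then $$\int_X(\mathcal{M}_{\mathcal{T}}\phi)^p\,d\mu\le F\left[h^{-1}\Big(\frac{p f^{p-q}A-(p-q)f^p}{F}\Big)\right]^p,$$ where $h^{-1}$ is the inverse of the function $h:[1,\infty)\to(-\infty,q]$ given by $h(t)=pt^{p-q}-(p-q)t^p$.
   Context: Let $(X,\mu)$ be a non-atomic probability space. Two measurable sets $A,B\subseteq X$ are almost disjoint if $\mu(A\cap B)=0$. A set $\mathcal{T}$ of measurable subsets of $X$ is called a tree if: (i) $X\in\mathcal{T}$ and $\mu(I)>0$ for every $I\in\mathcal{T}$; (ii) to every $I\in\mathcal{T}$ there corresponds a finite or countable subset $\mathcal{C}(I)\subseteq\mathcal{T}$ containing at least two elements such that (a) the elements of $\mathcal{C}(I)$ are pairwise almost disjoint subsets of $I$, and (b) $I=\bigcup\mathcal{C}(I)$; (iii) $\mathcal{T}=\bigcup_{m\ge 0}\mathcal{T}_{(m)}$, where $\mathcal{T}_{(0)}=\{X\}$ and $\mathcal{T}_{(m+1)}=\bigcup_{I\in\mathcal{T}_{(m)}}\mathcal{C}(I)$; (iv) $\lim_{m\to\infty}\sup_{I\in\mathcal{T}_{(m)}}\mu(I)=0$. For $\phi\in L^1(X,\mu)$ the associated maximal operator is $$\mathcal{M}_{\mathcal{T}}\phi(x)=\sup\Big\{\frac{1}{\mu(I)}\int_I|\phi|\,d\mu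 : x\in I\in\mathcal{T}\Big\}.$$ The function $h(t)=pt^{p-q}-(p-q)t^p$ is a strictly decreasing bijection from $[1,\infty)$ onto $(-\infty,q]$, so $h^{-1}:(-\infty,q]\to[1,\infty)$ is well defined. *)

theory Defs
  imports "HOL-Probability.Probability"
begin

definition non_atomic :: "'a measure \<Rightarrow> bool" where
  "non_atomic M \<longleftrightarrow>
     (\<forall>A\<in>sets M. emeasure M A > 0 \<longrightarrow>
        (\<exists>B\<in>sets M. B \<subseteq> A \<and> 0 < emeasure M B \<and> emeasure M B < emeasure M A))"

definition almost_disjoint :: "'a measure \<Rightarrow> 'a set \<Rightarrow> 'a set \<Rightarrow> bool" where
  "almost_disjoint M A B \<longleftrightarrow> emeasure M (A \<inter> B) = 0"

primrec tree_level :: "'a measure \<Rightarrow> ('a set \<Rightarrow> 'a set set) \<Rightarrow> nat \<Rightarrow> 'a set set" where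
  "tree_level M C 0 = {space M}"
| "tree_level M C (Suc m) = (\<Union>I\<in>tree_level M C m. C I)"

(* The supremum in the last clause is taken over a nonempty set of reals bounded by
   measure M (space M), so the real-valued SUP is the genuine supremum. *)
definition is_tree :: "'a measure \<Rightarrow> 'a set set \<Rightarrow> bool" where
  "is_tree M T \<longleftrightarrow>
     T \<subseteq> sets M \<and> space M \<in> T \<and> (\<forall>I\<in>T. emeasure M I > 0) \<and>
     (\<exists>C. (\<forall>I\<in>T. C I \<subseteq> T \<and> countable (C I) \<and> (\<exists>J\<in>C I. \<exists>K\<in>C I. J \<noteq> K) \<and>
                   (\<forall>J\<in>C I. J \<subseteq> I) \<and> pairwise (almost_disjoint M) (C I) \<and> I = \<Union>(C I)) \<and>
          T = (\<Union>m. tree_level M C m) \<and>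
          (\<lambda>m. SUP I\<in>tree_level M C m. measure M I) \<longlonglongrightarrow> 0)"

(* Valued in [0,\<infinity>], since the supremum may be infinite at some points. *)
definition tree_maximal ::
    "'a measure \<Rightarrow> 'a set set \<Rightarrow> ('a \<Rightarrow> real) \<Rightarrow> 'a \<Rightarrow> ennreal" where
  "tree_maximal M T \<phi> x =
     (SUP I\<in>{I\<in>T. x \<in> I}. ennreal (1 / measure M I * (LINT y:I|M. \<bar>\<phi> y\<bar>)))"

(* Real powers on [0,\<infinity>], used for positive exponents only, with \<infinity> to the p equal to \<infinity>. *)
definition ennreal_powr :: "ennreal \<Rightarrow> real \<Rightarrow> ennreal" where
  "ennreal_powr x p = (if x = \<top> then \<top> else ennreal (enn2real x powr p))"

definition h_fun :: "real \<Rightarrow> real \<Rightarrow> real \<Rightarrow> real" where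
  "h_fun p q t = p * t powr (p - q) - (p - q) * t powr p"

(* Meaningful on the image {..q} of {1..}, on which h_fun p q is injective when 1 < q < p. *)
definition h_inv :: "real \<Rightarrow> real \<Rightarrow> real \<Rightarrow> real" where
  "h_inv p q = inv_into {1..} (h_fun p q)"

end

(* The pointwise supremum is controlled through a weak type inequality for the q-th power,
   l^q mu(M phi > l) <= integral of phi^q over {M phi > l}, which follows from Jensen's inequality on
   the tree sets with mean above l, as these form a laminar family. Integrating it against
   l^(p-q-1) dl from f to infinity gives, for a truncation m of M phi,
     (p-q) (int m^p - f^p) <= p int phi^q (m^(p-q) - f^(p-q)).
   Young's inequality (t phi)^q m^(p-q) <= (q/p) (t phi)^p + ((p-q)/p) m^p then yields int m^p <= F t^p
   for every t > 1 such that F h(t) <= p f^(p-q) A - (p-q) f^p. *)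

theory Submission
  imports Defs
begin

section \<open>Young's inequality for real powers\<close>

text \<open>Weighted arithmetic-geometric mean inequality with weights q/p and (p-q)/p, multiplied
  by p. It serves four times: as the tangent line behind the weak type inequality, for the bound on
  h, in the final absorption, and to place the argument of \<open>h_inv\<close> in its
  domain.\<close>

lemma Youngs_inequality_powr:
  fixes a b p q :: real
  assumes "0 \<le> a" "0 \<le> b" "0 < q" "q < p"
  shows "p * (a powr q * b powr (p - q)) \<le> q * a powr p + (p - q) * b powr p"
proof (cases "a = 0 \<or> b = 0")
  case True
  then show ?thesis using assms by auto
next
  case False
  have "(a powr p) powr (q / p) * (b powr p) powr ((p - q) / p)
      \<le> q / p * a powr p + (p - q) / p * b powr p"
    using False assms by (intro Youngs_inequality_0) (auto simp: field_simps)
  then have "p * (a powr q * b powr (p - q)) \<le> p * (q / p * a powr p + (p - q) / p * b powr p)"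
    using assms by (simp add: powr_powr)
  also have "\<dots> = q * a powr p + (p - q) * b powr p"
    using assms by (simp add: field_simps)
  finally show ?thesis .
qed

section \<open>Measure comparison on unions of laminar families\<close>

text \<open>Overlaps are null for \<open>M\<close>, hence for \<open>N\<close> by absolute
  continuity, so \<open>N\<close> is additive over \<open>S\<close>; for \<open>M\<close>
  subadditivity is enough.\<close>

lemma emeasure_Union_almost_disjoint_ge:
  assumes ac: "absolutely_continuous M N" and sets: "sets N = sets M"
    and "finite S" "S \<subseteq> sets M"
    and "pairwise (almost_disjoint M) S"
    and "\<And>I. I \<in> S \<Longrightarrow> c * emeasure M I \<le> emeasure N I"
  shows "c * emeasure M (\<Union>S) \<le> emeasure N (\<Union>S)"
  using assms(3-)
proof (induction S rule: finite_induct)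
  case empty
  then show ?case by simp
next
  case (insert I S)
  have [measurable]: "I \<in> sets M" "\<And>J. J \<in> S \<Longrightarrow> J \<in> sets M" "\<Union>S \<in> sets M"
    using insert.prems insert.hyps by (auto intro: sets.finite_Union)
  have "I \<inter> J \<in> null_sets M" if "J \<in> S" for J
    using insert.prems(2) insert.hyps that
    by (auto simp: pairwise_def almost_disjoint_def null_sets_def)
  then have "(\<Union>J\<in>S. I \<inter> J) \<in> null_sets M"
    using insert.hyps by (intro null_sets_UN') (auto intro: countable_finite)
  moreover have "(\<Union>J\<in>S. I \<inter> J) = I \<inter> \<Union>S"
    by blast
  ultimately have "I \<inter> \<Union>S \<in> null_sets N"
    using ac unfolding absolutely_continuous_def by (simp only: subset_iff)
  then have *: "emeasure N (I \<union> \<Union>S) = emeasure N I + emeasure N (\<Union>S)"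
    using emeasure_Un_Int[of I N "\<Union>S"] by (simp add: sets null_setsD1)
  have "c * emeasure M (I \<union> \<Union>S) \<le> c * (emeasure M I + emeasure M (\<Union>S))"
    by (intro mult_left_mono emeasure_subadditive) auto
  also have "\<dots> \<le> emeasure N I + emeasure N (\<Union>S)"
    using insert.prems insert.IH by (auto simp: distrib_left pairwise_insert intro!: add_mono)
  finally show ?case using * by simp
qed

lemma emeasure_Union_laminar_finite_ge:
  assumes ac: "absolutely_continuous M N" and sets: "sets N = sets M"
    and "finite S" "S \<subseteq> sets M"
    and "\<And>I J. I \<in> S \<Longrightarrow> J \<in> S \<Longrightarrow> I \<subseteq> J \<or> J \<subseteq> I \<or> almost_disjoint M I J"
    and "\<And>I. I \<in> S \<Longrightarrow> c * emeasure M I \<le> emeasure N I"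
  shows "c * emeasure M (\<Union>S) \<le> emeasure N (\<Union>S)"
  using assms(3-)
proof (induction S rule: finite_psubset_induct)
  case (psubset S)
  show ?case
  proof (cases "\<exists>I\<in>S. \<exists>J\<in>S. I \<noteq> J \<and> I \<subseteq> J")
    case True
    then obtain I J where IJ: "I \<in> S" "J \<in> S" "I \<noteq> J" "I \<subseteq> J"
      by blast
    then have "\<Union>(S - {I}) = \<Union>S"
      by blast
    moreover have "c * emeasure M (\<Union>(S - {I})) \<le> emeasure N (\<Union>(S - {I}))"
      using IJ psubset.prems by (intro psubset.IH) blast+
    ultimately show ?thesis
      by simp
  next
    case False
    then have "pairwise (almost_disjoint M) S"
      using psubset.prems(2) unfolding pairwise_def by blast
    then show ?thesis
      using psubset.prems psubset.hyps
      by (intro emeasure_Union_almost_disjoint_ge[OF ac sets]) simp_all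
  qed
qed

text \<open>Finite initial segments of an enumeration of \<open>S\<close> have increasing unions,
  and both measures are continuous from below. This avoids selecting maximal members in an infinite
  family.\<close>

lemma emeasure_Union_laminar_ge:
  assumes ac: "absolutely_continuous M N" and sets: "sets N = sets M"
    and S: "countable S" "S \<subseteq> sets M"
    and laminar: "\<And>I J. I \<in> S \<Longrightarrow> J \<in> S \<Longrightarrow> I \<subseteq> J \<or> J \<subseteq> I \<or> almost_disjoint M I J"
    and ge: "\<And>I. I \<in> S \<Longrightarrow> c * emeasure M I \<le> emeasure N I"
  shows "c * emeasure M (\<Union>S) \<le> emeasure N (\<Union>S)"
proof (cases "S = {}")
  case False
  define V where "V n = from_nat_into S ` {..n}" for n
  define U where "U n = \<Union>(V n)" for n
  have V: "V n \<subseteq> S" "finite (V n)" for n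
    using from_nat_into[OF False] by (auto simp: V_def)
  have [measurable]: "U n \<in> sets M" for n
    unfolding U_def using V[of n] S(2) by (intro sets.finite_Union) auto
  have "incseq U"
    unfolding U_def V_def incseq_def by (intro allI impI Union_mono image_mono) auto
  have "range (from_nat_into S) = S"
    using False S(1) by (rule range_from_nat_into)
  moreover have "(\<Union>n. U n) = \<Union>(range (from_nat_into S))"
    unfolding U_def V_def by blast
  ultimately have Un: "(\<Union>n. U n) = \<Union>S"
    by (simp only:)
  have "c * emeasure M (U n) \<le> emeasure N (U n)" for n
    unfolding U_def
  proof (rule emeasure_Union_laminar_finite_ge[OF ac sets V(2)])
    show "V n \<subseteq> sets M"
      using V(1)[of n] S(2) by (rule order_trans)
  qed (use V(1)[of n] laminar ge in \<open>simp_all add: subset_iff\<close>)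
  then have "(SUP n. c * emeasure M (U n)) \<le> (SUP n. emeasure N (U n))"
    by (intro SUP_mono) auto
  then show ?thesis
    using SUP_emeasure_incseq[of U M] SUP_emeasure_incseq[of U N] \<open>incseq U\<close>
    by (simp add: Un sets image_subset_iff flip: SUP_mult_left_ennreal)
qed simp

section \<open>Trees are countable and laminar\<close>

lemma is_treeE:
  assumes "is_tree M T"
  obtains C where "T \<subseteq> sets M" "T = (\<Union>m. tree_level M C m)"
    "\<forall>I\<in>T. countable (C I) \<and> (\<forall>J\<in>C I. J \<subseteq> I) \<and> pairwise (almost_disjoint M) (C I)"
  using assms unfolding is_tree_def
  apply (elim conjE exE)
  subgoal premises prems for C
    by (rule prems(1)[of C]) (fact prems, fact prems, use prems(5) in blast)
  done

text \<open>Makes the maximal function a countable supremum and lets the laminar estimate apply to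
  any subfamily of the tree.\<close>

lemma tree_countable:
  assumes "is_tree M T"
  shows "countable T"
proof -
  obtain C where "T \<subseteq> sets M" and T: "T = (\<Union>m. tree_level M C m)"
    and C: "\<forall>I\<in>T. countable (C I) \<and> (\<forall>J\<in>C I. J \<subseteq> I) \<and> pairwise (almost_disjoint M) (C I)"
    using assms by (rule is_treeE)
  have "countable (tree_level M C m)" for m
  proof (induction m)
    case (Suc m)
    have "tree_level M C m \<subseteq> T"
      using T by blast
    then show ?case
      using Suc C by (auto intro!: countable_UN)
  qed simp
  then show ?thesis
    unfolding T by (intro countable_UN) auto
qed

text \<open>The deeper of the two sets lies in an ancestor on the level of the other one, and two
  sets of the same level are equal or almost disjoint.\<close>

lemma tree_laminar:
  assumes tree: "is_tree M T" and "I \<in> T" "J \<in> T"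
  shows "I \<subseteq> J \<or> J \<subseteq> I \<or> almost_disjoint M I J"
proof -
  obtain C where TM: "T \<subseteq> sets M" and T: "T = (\<Union>m. tree_level M C m)"
    and C: "\<forall>I\<in>T. countable (C I) \<and> (\<forall>J\<in>C I. J \<subseteq> I) \<and> pairwise (almost_disjoint M) (C I)"
    using tree by (rule is_treeE)
  have sub: "J \<subseteq> I" if "I \<in> T" "J \<in> C I" for I J
    using C that by blast
  have disj: "pairwise (almost_disjoint M) (C I)" if "I \<in> T" for I
    using C that by blast
  have lev: "tree_level M C m \<subseteq> T" for m
    using T by blast
  have mono: "almost_disjoint M I J"
    if "almost_disjoint M I' J'" "I \<subseteq> I'" "J \<subseteq> J'" "I' \<in> T" "J' \<in> T" for I J I' J'
  proof -
    have "emeasure M (I \<inter> J) \<le> emeasure M (I' \<inter> J')"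
      using that TM by (intro emeasure_mono) auto
    then show ?thesis
      using that by (simp add: almost_disjoint_def)
  qed
  \<comment> \<open>Children of one parent are almost disjoint by assumption; children of distinct
    parents inherit it from the parents.\<close>
  have same: "I = J \<or> almost_disjoint M I J"
    if "I \<in> tree_level M C m" "J \<in> tree_level M C m" for I J m
    using that
  proof (induction m arbitrary: I J)
    case (Suc m)
    then obtain I' J' where *: "I' \<in> tree_level M C m" "I \<in> C I'" "J' \<in> tree_level M C m" "J \<in> C J'"
      by auto
    then have "I' \<in> T" "J' \<in> T"
      using lev by blast+
    show ?case
    proof (cases "I' = J'")
      case True
      then show ?thesis
        using disj[OF \<open>J' \<in> T\<close>] * unfolding pairwise_def by blast
    next
      case False
      then have "almost_disjoint M I' J'"
        using Suc.IH * by blast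
      then show ?thesis
        using mono[of I' J' I J] sub * \<open>I' \<in> T\<close> \<open>J' \<in> T\<close> by blast
    qed
  qed simp
  have anc: "\<exists>K\<in>tree_level M C m. I \<subseteq> K" if "I \<in> tree_level M C (m + d)" for I m d
    using that
  proof (induction d arbitrary: I)
    case (Suc d)
    then obtain I' where I': "I' \<in> tree_level M C (m + d)" "I \<in> C I'"
      by auto
    then have "I \<subseteq> I'"
      using sub lev by blast
    then show ?case
      using Suc.IH[OF I'(1)] by blast
  qed auto
  have main: "I \<subseteq> J \<or> almost_disjoint M I J"
    if lv: "I \<in> tree_level M C n" "J \<in> tree_level M C m" "m \<le> n" for I J m n
  proof -
    obtain K where K: "K \<in> tree_level M C m" "I \<subseteq> K"
      using anc[of I m "n - m"] lv by auto
    then show ?thesis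
      using same[OF K(1) lv(2)] mono[of K J I J] lev lv by blast
  qed
  obtain n m where nm: "I \<in> tree_level M C n" "J \<in> tree_level M C m"
    using assms T by blast
  show ?thesis
  proof (cases "m \<le> n")
    case True
    then show ?thesis
      using main[OF nm] by blast
  next
    case False
    then show ?thesis
      using main[OF nm(2,1)] by (auto simp: almost_disjoint_def Int_commute)
  qed
qed

section \<open>Layer cake formula with a weight\<close>

text \<open>Writes g^r - c^r as the integral of r l^(r-1) over l from c to g and exchanges the
  integrals. The weight \<open>\<psi>\<close> lets the formula serve both sides of the moment
  inequality: a constant on one, a multiple of u^q on the other.\<close>

lemma nn_integral_layer_cake_powr:
  fixes g :: "'a \<Rightarrow> real"
  assumes "sigma_finite_measure M"
    and [measurable]: "g \<in> borel_measurable M" "\<psi> \<in> borel_measurable M"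
    and "0 < c" and g: "\<And>x. c \<le> g x" and "0 < r"
  shows "(\<integral>\<^sup>+x. \<psi> x * ennreal (g x powr r - c powr r) \<partial>M)
       = (\<integral>\<^sup>+l. ennreal (r * l powr (r - 1)) * indicator {c..} l
             * (\<integral>\<^sup>+x. \<psi> x * indicator {x \<in> space M. l < g x} x \<partial>M) \<partial>lborel)"
proof -
  interpret M: sigma_finite_measure M by fact
  interpret P: pair_sigma_finite M lborel ..
  have "ennreal (g x powr r - c powr r)
      = (\<integral>\<^sup>+l. ennreal (r * l powr (r - 1)) * indicator {c..} l * indicator {..<g x} l \<partial>lborel)" for x
  proof -
    have "ennreal (g x powr r - c powr r)
        = (\<integral>\<^sup>+l. ennreal (r * l powr (r - 1)) * indicator {c..g x} l \<partial>lborel)"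
      using assms g[of x]
      by (intro nn_integral_FTC_Icc[symmetric])
         (auto intro!: DERIV_powr derivative_eq_intros simp: powr_diff)
    \<comment> \<open>The endpoint l = g x is a null set; removing it produces the strict superlevel
      sets of the weak type inequality.\<close>
    also have "\<dots> = (\<integral>\<^sup>+l. ennreal (r * l powr (r - 1)) * indicator {c..} l * indicator {..<g x} l \<partial>lborel)"
      by (rule nn_integral_cong_AE, use AE_lborel_singleton[of "g x"] in eventually_elim)
         (auto simp: indicator_def)
    finally show ?thesis .
  qed
  then have "(\<integral>\<^sup>+x. \<psi> x * ennreal (g x powr r - c powr r) \<partial>M)
      = (\<integral>\<^sup>+x. \<integral>\<^sup>+l. \<psi> x * (ennreal (r * l powr (r - 1)) * indicator {c..} l * indicator {..<g x} l) \<partial>lborel \<partial>M)"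
    by (simp add: nn_integral_cmult)
  \<comment> \<open>The indicator is rewritten as that of a subset of the product space, which
    exhibits joint measurability for Fubini.\<close>
  also have "\<dots> = (\<integral>\<^sup>+x. \<integral>\<^sup>+l. \<psi> x * (ennreal (r * l powr (r - 1)) * indicator {c..} l
      * indicator {z \<in> space (M \<Otimes>\<^sub>M lborel). snd z < g (fst z)} (x, l)) \<partial>lborel \<partial>M)"
    by (intro nn_integral_cong) (auto simp: indicator_def space_pair_measure)
  also have "\<dots> = (\<integral>\<^sup>+l. \<integral>\<^sup>+x. \<psi> x * (ennreal (r * l powr (r - 1)) * indicator {c..} l
      * indicator {z \<in> space (M \<Otimes>\<^sub>M lborel). snd z < g (fst z)} (x, l)) \<partial>M \<partial>lborel)"
    by (rule P.Fubini'[symmetric]) measurable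
  also have "\<dots> = (\<integral>\<^sup>+l. \<integral>\<^sup>+x. ennreal (r * l powr (r - 1)) * indicator {c..} l
      * (\<psi> x * indicator {x \<in> space M. l < g x} x) \<partial>M \<partial>lborel)"
    by (intro nn_integral_cong) (auto simp: indicator_def space_pair_measure mult_ac)
  also have "\<dots> = (\<integral>\<^sup>+l. ennreal (r * l powr (r - 1)) * indicator {c..} l
             * (\<integral>\<^sup>+x. \<psi> x * indicator {x \<in> space M. l < g x} x \<partial>M) \<partial>lborel)"
    by (simp add: nn_integral_cmult)
  finally show ?thesis .
qed

section \<open>The function h and its inverse\<close>

text \<open>Young's inequality for the pair 1 and t.\<close>

lemma h_fun_le:
  assumes "0 < q" "q < p" "0 \<le> t"
  shows "h_fun p q t \<le> q"
  using Youngs_inequality_powr[of 1 t q p] assms by (simp add: h_fun_def)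

text \<open>\<open>inv_into\<close> returns a preimage as soon as one exists, and existence follows
  from the intermediate value theorem: h equals q at 1 and is at most s at a sufficiently large
  point b.\<close>

lemma h_inv_correct:
  assumes "0 < q" "q < p" "s \<le> q"
  shows "1 \<le> h_inv p q s" "h_fun p q (h_inv p q s) = s"
proof -
  \<comment> \<open>Chosen so that (p-q) b^q = p + |s|; then h(b) = b^(p-q) (p - (p-q) b^q) =
    -b^(p-q) |s|, which is at most -|s| because b is at least 1.\<close>
  define b where "b = ((p + \<bar>s\<bar>) / (p - q)) powr (1 / q)"
  have ge1: "1 \<le> (p + \<bar>s\<bar>) / (p - q)"
    using assms by (simp add: field_simps)
  then have b1: "1 \<le> b"
    unfolding b_def using assms by (intro ge_one_powr_ge_zero) auto
  have "b powr q = (p + \<bar>s\<bar>) / (p - q)"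
    unfolding b_def using assms ge1 by (simp add: powr_powr)
  then have bq: "(p - q) * b powr q = p + \<bar>s\<bar>"
    using assms by simp
  have "h_fun p q b = b powr (p - q) * (p - (p - q) * b powr q)"
    using b1 by (simp add: h_fun_def algebra_simps flip: powr_add)
  also have "\<dots> = - (b powr (p - q) * \<bar>s\<bar>)"
    by (simp add: bq)
  also have "\<dots> \<le> - (1 * \<bar>s\<bar>)"
    using b1 assms by (intro le_imp_neg_le mult_right_mono ge_one_powr_ge_zero) auto
  finally have "h_fun p q b \<le> s"
    by linarith
  moreover have "h_fun p q 1 = q"
    by (simp add: h_fun_def)
  moreover have "continuous_on {1..b} (h_fun p q)"
    unfolding h_fun_def by (intro continuous_intros) auto
  ultimately have "\<exists>x. 1 \<le> x \<and> x \<le> b \<and> h_fun p q x = s"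
    using assms b1 by (intro IVT2') auto
  then have "s \<in> h_fun p q ` {1..}"
    by auto
  then show "1 \<le> h_inv p q s" "h_fun p q (h_inv p q s) = s"
    using inv_into_into[of s "h_fun p q" "{1..}"] unfolding h_inv_def
    by (auto intro: f_inv_into_f)
qed

lemma (in finite_measure) integrable_powr_mono:
  fixes u :: "'a \<Rightarrow> real"
  assumes [measurable]: "u \<in> borel_measurable M" and nonneg: "\<And>x. 0 \<le> u x"
    and int: "integrable M (\<lambda>x. u x powr p)" and "0 < r" "r \<le> p"
  shows "integrable M (\<lambda>x. u x powr r)"
proof (rule Bochner_Integration.integrable_bound)
  show "integrable M (\<lambda>x. 1 + u x powr p)"
    using int by simp
  have "y powr r \<le> 1 + y powr p" if "0 \<le> y" for y :: real
  proof (cases "y \<le> 1")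
    case True
    then have "y powr r \<le> 1"
      using \<open>0 < r\<close> that powr_mono2[of r y 1] by simp
    then show ?thesis
      by (simp add: add_increasing2)
  next
    case False
    then have "y powr r \<le> y powr p"
      using \<open>r \<le> p\<close> by simp
    then show ?thesis
      by linarith
  qed
  then show "AE x in M. norm (u x powr r) \<le> norm (1 + u x powr p)"
    using nonneg by simp
qed measurable

section \<open>The weak type inequality for the maximal function\<close>

text \<open>Jensen's inequality on \<open>I\<close> in tangent line form: q l^(q-1) y <= y^q + (q-1)
  l^q is integrated over \<open>I\<close>, and the mean exceeding l leaves q l^q - (q-1) l^q = l^q
  as the factor of the measure of \<open>I\<close>.\<close>

lemma weak_type_on_set:
  assumes "prob_space M" and [measurable]: "I \<in> sets M" "\<phi> \<in> borel_measurable M"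
    and int: "integrable M (\<lambda>x. \<bar>\<phi> x\<bar>)" "integrable M (\<lambda>x. \<bar>\<phi> x\<bar> powr q)"
    and "1 < q" "0 < l" and avg: "l < 1 / measure M I * (LINT y:I|M. \<bar>\<phi> y\<bar>)"
  shows "ennreal (l powr q) * emeasure M I \<le> (\<integral>\<^sup>+x\<in>I. ennreal (\<bar>\<phi> x\<bar> powr q) \<partial>M)"
proof -
  interpret prob_space M by fact
  \<comment> \<open>For measure 0 the mean would be 0, since 1 / 0 = 0, and could not exceed
    l.\<close>
  have "measure M I \<noteq> 0"
    using avg \<open>0 < l\<close> by auto
  then have pos: "0 < measure M I"
    by (simp add: zero_less_measure_iff)
  have i1: "integrable M (\<lambda>x. indicator I x * \<bar>\<phi> x\<bar>)"
    and iq: "integrable M (\<lambda>x. indicator I x * \<bar>\<phi> x\<bar> powr q)"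
    using integrable_mult_indicator[OF \<open>I \<in> sets M\<close> int(1)]
      integrable_mult_indicator[OF \<open>I \<in> sets M\<close> int(2)] by simp_all
  have iI: "integrable M (\<lambda>x. (q - 1) * l powr q * indicator I x)"
    by (intro integrable_mult_right integrable_real_indicator) (auto simp: less_top[symmetric])
  have "l * measure M I < (LINT y|M. indicator I y * \<bar>\<phi> y\<bar>)"
    using avg pos by (simp add: set_lebesgue_integral_def field_simps)
  then have "q * l powr (q - 1) * (l * measure M I) \<le> q * l powr (q - 1) * (LINT y|M. indicator I y * \<bar>\<phi> y\<bar>)"
    using \<open>1 < q\<close> by (intro mult_left_mono) auto
  also have "\<dots> = (LINT y|M. q * l powr (q - 1) * (indicator I y * \<bar>\<phi> y\<bar>))"
    by simp
  also have "\<dots> \<le> (LINT y|M. indicator I y * \<bar>\<phi> y\<bar> powr q + (q - 1) * l powr q * indicator I y)"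
  proof (rule integral_mono)
    show "q * l powr (q - 1) * (indicator I y * \<bar>\<phi> y\<bar>)
        \<le> indicator I y * \<bar>\<phi> y\<bar> powr q + (q - 1) * l powr q * indicator I y" for y
      using Youngs_inequality_powr[of "\<bar>\<phi> y\<bar>" l 1 q] \<open>1 < q\<close> \<open>0 < l\<close>
      by (simp add: indicator_def mult_ac)
  qed (use i1 Bochner_Integration.integrable_add[OF iq iI] in simp_all)
  also have "\<dots> = (LINT y|M. indicator I y * \<bar>\<phi> y\<bar> powr q) + (q - 1) * l powr q * measure M I"
    using Bochner_Integration.integral_add[OF iq iI] by simp
  finally have "l powr q * measure M I \<le> (LINT y|M. indicator I y * \<bar>\<phi> y\<bar> powr q)"
    using \<open>0 < l\<close> by (simp add: powr_diff field_simps)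
  then have "ennreal (l powr q * measure M I) \<le> (\<integral>\<^sup>+y. ennreal (indicator I y * \<bar>\<phi> y\<bar> powr q) \<partial>M)"
    using iq by (simp add: nn_integral_eq_integral ennreal_leI)
  also have "\<dots> = (\<integral>\<^sup>+x\<in>I. ennreal (\<bar>\<phi> x\<bar> powr q) \<partial>M)"
    by (intro nn_integral_cong) (auto simp: indicator_def)
  finally show ?thesis
    by (simp add: emeasure_eq_measure ennreal_mult)
qed

text \<open>With indicators the index set no longer depends on x. The added terms are 0, the least
  element of [0, infinity], so they do not change the supremum, not even where it is taken over the
  empty set.\<close>

lemma tree_maximal_measurable:
  assumes "is_tree M T"
  shows "tree_maximal M T \<phi> \<in> borel_measurable M"
proof -
  obtain C where TM: "T \<subseteq> sets M"
    using assms by (rule is_treeE)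
  have "tree_maximal M T \<phi> x
      = (SUP I\<in>T. ennreal (1 / measure M I * (LINT y:I|M. \<bar>\<phi> y\<bar>)) * indicator I x)" for x
    unfolding tree_maximal_def
    by (intro antisym SUP_least)
       (auto intro: SUP_upper2 simp: indicator_def split: if_split)
  then have "tree_maximal M T \<phi>
      = (\<lambda>x. SUP I\<in>T. ennreal (1 / measure M I * (LINT y:I|M. \<bar>\<phi> y\<bar>)) * indicator I x)"
    by blast
  also have "\<dots> \<in> borel_measurable M"
    using tree_countable[OF assms] TM by (intro borel_measurable_SUP) auto
  finally show ?thesis .
qed

text \<open>The superlevel set is the union of the tree sets with mean above l. The estimate on each
  of them compares \<open>M\<close> with the density measure of |phi|^q, and laminarity carries it
  over to the union.\<close>

lemma tree_maximal_weak_type: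
  assumes "prob_space M" "is_tree M T" and [measurable]: "\<phi> \<in> borel_measurable M"
    and int: "integrable M (\<lambda>x. \<bar>\<phi> x\<bar>)" "integrable M (\<lambda>x. \<bar>\<phi> x\<bar> powr q)"
    and "1 < q" "0 < l"
  defines "E \<equiv> {x \<in> space M. ennreal l < tree_maximal M T \<phi> x}"
  shows "ennreal (l powr q) * emeasure M E \<le> (\<integral>\<^sup>+x\<in>E. ennreal (\<bar>\<phi> x\<bar> powr q) \<partial>M)"
proof -
  obtain C where TM: "T \<subseteq> sets M"
    using assms(2) by (rule is_treeE)
  define S where "S = {I \<in> T. l < 1 / measure M I * (LINT y:I|M. \<bar>\<phi> y\<bar>)}"
  define N where "N = density M (\<lambda>x. ennreal (\<bar>\<phi> x\<bar> powr q))"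
  have "S \<subseteq> T"
    by (auto simp: S_def)
  then have S: "countable S" "S \<subseteq> sets M"
    using tree_countable[OF assms(2)] TM by (auto intro: countable_subset)
  \<comment> \<open>A supremum is strictly above l exactly when one of its terms is.\<close>
  have ES: "E = \<Union>S"
    using \<open>0 < l\<close> TM sets.sets_into_space
    by (auto simp: E_def S_def tree_maximal_def less_SUP_iff ennreal_less_iff)
  have [measurable]: "E \<in> sets M"
    unfolding ES using S by (intro sets.countable_Union)
  have "ennreal (l powr q) * emeasure M (\<Union>S) \<le> emeasure N (\<Union>S)"
  proof (rule emeasure_Union_laminar_ge[OF _ _ S])
    show "absolutely_continuous M N"
      unfolding N_def by (intro absolutely_continuousI_density) measurable
    show "I \<subseteq> J \<or> J \<subseteq> I \<or> almost_disjoint M I J" if "I \<in> S" "J \<in> S" for I J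
      using tree_laminar[OF assms(2)] \<open>S \<subseteq> T\<close> that by blast
    show "ennreal (l powr q) * emeasure M I \<le> emeasure N I" if "I \<in> S" for I
    proof -
      have "I \<in> sets M" "l < 1 / measure M I * (LINT y:I|M. \<bar>\<phi> y\<bar>)"
        using that S by (auto simp: S_def)
      then show ?thesis
        using weak_type_on_set[OF assms(1) _ _ int, of I l] assms(3,6,7)
        by (simp add: N_def emeasure_density)
    qed
  qed (simp add: N_def)
  then show ?thesis
    by (simp add: N_def emeasure_density flip: ES)
qed

section \<open>From the weak type inequality to a moment bound\<close>

text \<open>The weak type inequality is multiplied by p (p-q) l^(p-q-1) and integrated over l >= c;
  the layer cake formula with exponents p and p-q evaluates the two sides. The bound
  \<open>K\<close> on \<open>g\<close> keeps the integrals finite, so that the inequality can be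
  read in the reals.\<close>

lemma weak_type_imp_moment_inequality:
  fixes g u :: "'a \<Rightarrow> real"
  assumes "finite_measure M"
    and meas [measurable]: "g \<in> borel_measurable M" "u \<in> borel_measurable M"
    and "0 < c" and g: "\<And>x. c \<le> g x" "\<And>x. g x \<le> K"
    and "q < p" "0 < q" and uq: "integrable M (\<lambda>x. u x powr q)"
    and weak: "\<And>l. c \<le> l \<Longrightarrow> ennreal (l powr q) * emeasure M {x \<in> space M. l < g x}
      \<le> (\<integral>\<^sup>+x\<in>{x \<in> space M. l < g x}. ennreal (u x powr q) \<partial>M)"
  shows "(p - q) * (LINT x|M. g x powr p - c powr p)
      \<le> p * (LINT x|M. u x powr q * (g x powr (p - q) - c powr (p - q)))"
proof -
  interpret finite_measure M by fact
  have sf: "sigma_finite_measure M" ..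
  have le: "c powr r \<le> g x powr r" "g x powr r \<le> K powr r" if "0 < r" for r x
    using that \<open>0 < c\<close> g(1)[of x] g(2)[of x] by (auto intro!: powr_mono2)
  have diff: "0 \<le> g x powr r - c powr r" "g x powr r - c powr r \<le> K powr r" if "0 < r" for r x
    using le[OF that, of x] powr_ge_zero[of c r] by linarith+
  have "0 < p" "0 < p - q"
    using \<open>0 < q\<close> \<open>q < p\<close> by simp_all
  have lhs: "integrable M (\<lambda>x. (p - q) * (g x powr p - c powr p))"
    using diff[OF \<open>0 < p\<close>]
    by (intro integrable_mult_right integrable_const_bound[where B = "K powr p"] AE_I2)
       (simp_all only: real_norm_def abs_of_nonneg, measurable)
  have "integrable M (\<lambda>x. p * K powr (p - q) * u x powr q)"
    using uq by (intro integrable_mult_right)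
  then have rhs: "integrable M (\<lambda>x. p * (u x powr q * (g x powr (p - q) - c powr (p - q))))"
  proof (rule Bochner_Integration.integrable_bound)
    have "norm (p * (u x powr q * (g x powr (p - q) - c powr (p - q))))
        \<le> norm (p * K powr (p - q) * u x powr q)" for x
    proof -
      have "u x powr q * (g x powr (p - q) - c powr (p - q)) \<le> u x powr q * K powr (p - q)"
        using diff(2)[OF \<open>0 < p - q\<close>] by (intro mult_left_mono) simp_all
      then show ?thesis
        using diff(1)[OF \<open>0 < p - q\<close>, of x] \<open>0 < p\<close> by (simp add: abs_mult mult_ac)
    qed
    then show "AE x in M. norm (p * (u x powr q * (g x powr (p - q) - c powr (p - q))))
        \<le> norm (p * K powr (p - q) * u x powr q)"
      by (rule AE_I2)
  qed measurable
  have "(\<integral>\<^sup>+x. ennreal ((p - q) * (g x powr p - c powr p)) \<partial>M)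
      = (\<integral>\<^sup>+x. ennreal (p - q) * ennreal (g x powr p - c powr p) \<partial>M)"
    using \<open>q < p\<close> by (simp add: ennreal_mult')
  also have "\<dots> = (\<integral>\<^sup>+l. ennreal (p * l powr (p - 1)) * indicator {c..} l
             * (\<integral>\<^sup>+x. ennreal (p - q) * indicator {x \<in> space M. l < g x} x \<partial>M) \<partial>lborel)"
    using \<open>0 < c\<close> g(1) \<open>q < p\<close> \<open>0 < q\<close> by (intro nn_integral_layer_cake_powr[OF sf]) auto
  also have "\<dots> \<le> (\<integral>\<^sup>+l. ennreal ((p - q) * l powr (p - q - 1)) * indicator {c..} l
             * (\<integral>\<^sup>+x. ennreal (p * u x powr q) * indicator {x \<in> space M. l < g x} x \<partial>M) \<partial>lborel)"
  proof (rule nn_integral_mono)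
    fix l :: real
    let ?E = "{x \<in> space M. l < g x}"
    show "ennreal (p * l powr (p - 1)) * indicator {c..} l
             * (\<integral>\<^sup>+x. ennreal (p - q) * indicator ?E x \<partial>M)
        \<le> ennreal ((p - q) * l powr (p - q - 1)) * indicator {c..} l
             * (\<integral>\<^sup>+x. ennreal (p * u x powr q) * indicator ?E x \<partial>M)"
    proof (cases "c \<le> l")
      case True
      \<comment> \<open>Splits off the factor l^q to which the weak type inequality applies.\<close>
      have "p * l powr (p - 1) * (p - q) = (p - q) * l powr (p - q - 1) * p * l powr q"
        by (simp flip: powr_add)
      then have "ennreal (p * l powr (p - 1)) * ennreal (p - q)
          = ennreal ((p - q) * l powr (p - q - 1)) * ennreal p * ennreal (l powr q)"
        using \<open>q < p\<close> \<open>0 < q\<close> by (simp flip: ennreal_mult')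
      then have "ennreal (p * l powr (p - 1)) * (ennreal (p - q) * emeasure M ?E)
          = ennreal ((p - q) * l powr (p - q - 1)) * (ennreal p * (ennreal (l powr q) * emeasure M ?E))"
        by (simp add: mult.assoc[symmetric])
      also have "\<dots> \<le> ennreal ((p - q) * l powr (p - q - 1)) 
          * (ennreal p * (\<integral>\<^sup>+x\<in>?E. ennreal (u x powr q) \<partial>M))"
        by (intro mult_left_mono weak[OF True]) auto
      also have "ennreal p * (\<integral>\<^sup>+x\<in>?E. ennreal (u x powr q) \<partial>M)
          = (\<integral>\<^sup>+x. ennreal p * (ennreal (u x powr q) * indicator ?E x) \<partial>M)"
        by (rule nn_integral_cmult[symmetric]) measurable
      also have "\<dots> = (\<integral>\<^sup>+x. ennreal (p * u x powr q) * indicator ?E x \<partial>M)"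
        using \<open>q < p\<close> \<open>0 < q\<close> by (simp add: ennreal_mult' mult.assoc)
      finally show ?thesis
        using True by (simp add: nn_integral_cmult)
    qed simp
  qed
  also have "\<dots> = (\<integral>\<^sup>+x. ennreal (p * u x powr q) * ennreal (g x powr (p - q) - c powr (p - q)) \<partial>M)"
    using \<open>0 < c\<close> g(1) \<open>q < p\<close> by (intro nn_integral_layer_cake_powr[OF sf, symmetric]) auto
  also have "\<dots> = (\<integral>\<^sup>+x. ennreal (p * (u x powr q * (g x powr (p - q) - c powr (p - q)))) \<partial>M)"
    using \<open>q < p\<close> \<open>0 < q\<close> by (simp add: mult.assoc flip: ennreal_mult')
  finally have "(LINT x|M. (p - q) * (g x powr p - c powr p))
      \<le> (LINT x|M. p * (u x powr q * (g x powr (p - q) - c powr (p - q))))"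
    using lhs rhs diff(1)[OF \<open>0 < p\<close>] diff(1)[OF \<open>0 < p - q\<close>] \<open>0 < p\<close> \<open>0 < p - q\<close>
    by (simp add: nn_integral_eq_integral integral_nonneg ennreal_le_iff)
  then show ?thesis
    by simp
qed

text \<open>An absorption argument: the moment inequality bounds G by the mixed integral B, Young's
  inequality bounds B by F and G, and eliminating B leaves G on the left with the factor (p-q) (t^q
  - 1), positive because t > 1.\<close>

lemma weak_type_imp_moment_bound:
  fixes g u :: "'a \<Rightarrow> real"
  assumes "prob_space M"
    and meas [measurable]: "g \<in> borel_measurable M" "u \<in> borel_measurable M"
    and "0 < c" and g: "\<And>x. c \<le> g x" "\<And>x. g x \<le> K"
    and u: "\<And>x. 0 \<le> u x" "integrable M (\<lambda>x. u x powr p)" and "q < p" "0 < q"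
    and weak: "\<And>l. c \<le> l \<Longrightarrow> ennreal (l powr q) * emeasure M {x \<in> space M. l < g x}
      \<le> (\<integral>\<^sup>+x\<in>{x \<in> space M. l < g x}. ennreal (u x powr q) \<partial>M)"
    and "1 < t" and h: "(LINT x|M. u x powr p) * h_fun p q t
      \<le> p * c powr (p - q) * (LINT x|M. u x powr q) - (p - q) * c powr p"
  shows "(LINT x|M. g x powr p) \<le> (LINT x|M. u x powr p) * t powr p"
proof -
  interpret prob_space M by fact
  define G B A F where "G = (LINT x|M. g x powr p)" "B = (LINT x|M. u x powr q * g x powr (p - q))"
    "A = (LINT x|M. u x powr q)" "F = (LINT x|M. u x powr p)"
  note defs = this
  have le: "g x powr r \<le> K powr r" if "0 < r" for r x
    using that \<open>0 < c\<close> g(1)[of x] g(2)[of x] by (intro powr_mono2) auto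
  have uq: "integrable M (\<lambda>x. u x powr q)"
    using integrable_powr_mono[OF meas(2) u \<open>0 < q\<close>] \<open>q < p\<close> by simp
  have "0 < p" "0 < p - q"
    using \<open>0 < q\<close> \<open>q < p\<close> by simp_all
  have gp: "integrable M (\<lambda>x. g x powr p)"
    using le[OF \<open>0 < p\<close>] by (intro integrable_const_bound[where B = "K powr p"] AE_I2) simp_all
  have "integrable M (\<lambda>x. K powr (p - q) * u x powr q)"
    using uq by (intro integrable_mult_right)
  then have ug: "integrable M (\<lambda>x. u x powr q * g x powr (p - q))"
  proof (rule Bochner_Integration.integrable_bound)
    have "norm (u x powr q * g x powr (p - q)) \<le> norm (K powr (p - q) * u x powr q)" for x
      using mult_left_mono[OF le[OF \<open>0 < p - q\<close>, of x], of "u x powr q"] by (simp add: abs_mult mult_ac)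
    then show "AE x in M. norm (u x powr q * g x powr (p - q)) \<le> norm (K powr (p - q) * u x powr q)"
      by (rule AE_I2)
  qed measurable
  have "(p - q) * (LINT x|M. g x powr p - c powr p)
      \<le> p * (LINT x|M. u x powr q * g x powr (p - q) - c powr (p - q) * u x powr q)"
    using weak_type_imp_moment_inequality[OF _ meas \<open>0 < c\<close> g \<open>q < p\<close> \<open>0 < q\<close> uq weak]
    by (simp add: finite_measure_axioms right_diff_distrib mult_ac)
  then have "(p - q) * (G - c powr p) \<le> p * (B - c powr (p - q) * A)"
    using gp ug uq by (simp add: defs prob_space)
  \<comment> \<open>The hypothesis on t replaces exactly the terms that contain c.\<close>
  with h have 1: "(p - q) * G + F * h_fun p q t \<le> p * B"
    by (simp add: defs algebra_simps)
  \<comment> \<open>Young's inequality is applied to t u and g, with equality where g = t u.\<close>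
  have "(LINT x|M. p * t powr q * (u x powr q * g x powr (p - q)))
      \<le> (LINT x|M. q * t powr p * u x powr p + (p - q) * g x powr p)"
  proof (rule integral_mono)
    show "p * t powr q * (u x powr q * g x powr (p - q))
        \<le> q * t powr p * u x powr p + (p - q) * g x powr p" for x
      using Youngs_inequality_powr[of "t * u x" "g x" q p] \<open>1 < t\<close> u(1)[of x] g(1)[of x] \<open>0 < c\<close> \<open>q < p\<close> \<open>0 < q\<close>
      by (simp add: powr_mult mult_ac)
  qed (use ug u(2) gp in simp_all)
  then have "p * t powr q * B \<le> q * t powr p * F + (p - q) * G"
    using ug u(2) gp by (simp add: defs)
  moreover have "t powr q * ((p - q) * G + F * h_fun p q t) \<le> t powr q * (p * B)"
    using 1 by (intro mult_left_mono) auto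
  moreover have "t powr q * h_fun p q t = p * t powr p - (p - q) * t powr p * t powr q"
    using \<open>1 < t\<close> by (simp add: h_fun_def powr_diff right_diff_distrib)
  then have "t powr q * (F * h_fun p q t) = F * (p * t powr p - (p - q) * t powr p * t powr q)"
    by (metis mult.left_commute)
  ultimately have "(p - q) * (t powr q - 1) * G \<le> (p - q) * (t powr q - 1) * (F * t powr p)"
    by (simp add: algebra_simps)
  moreover have "0 < (p - q) * (t powr q - 1)"
    using \<open>1 < t\<close> \<open>0 < q\<close> \<open>q < p\<close> by (simp add: gr_one_powr)
  ultimately have "G \<le> F * t powr p"
    by (rule mult_left_le_imp_le)
  then show ?thesis
    by (simp add: defs)
qed

section \<open>Truncation of the maximal function and passage to the limit\<close>

text \<open>For c <= l < K the superlevel sets of the truncation are those of the maximal function,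
  and for l >= K they are empty, so the weak type inequality survives. The maximum with c secures
  the lower bound that the layer cake formula requires at every point; for c = f it changes nothing
  on \<open>space M\<close>, because X is itself a tree set with mean f.\<close>

lemma tree_maximal_truncated_bound:
  assumes "prob_space M" "is_tree M T" and meas [measurable]: "\<phi> \<in> borel_measurable M"
    and int: "integrable M (\<lambda>x. \<bar>\<phi> x\<bar> powr p)"
    and "1 < q" "q < p" "0 < c" "c \<le> K" "1 < t"
    and h: "(LINT x|M. \<bar>\<phi> x\<bar> powr p) * h_fun p q t
      \<le> p * c powr (p - q) * (LINT x|M. \<bar>\<phi> x\<bar> powr q) - (p - q) * c powr p"
  defines "g \<equiv> \<lambda>x. max c (enn2real (min (ennreal K) (tree_maximal M T \<phi> x)))"
  shows "(\<integral>\<^sup>+x. ennreal (g x powr p) \<partial>M) \<le> ennreal ((LINT x|M. \<bar>\<phi> x\<bar> powr p) * t powr p)"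
proof -
  interpret prob_space M by fact
  note [measurable] = tree_maximal_measurable[OF assms(2)]
  have [measurable]: "g \<in> borel_measurable M"
    unfolding g_def by measurable
  have int1: "integrable M (\<lambda>x. \<bar>\<phi> x\<bar>)"
    using integrable_powr_mono[of "\<lambda>x. \<bar>\<phi> x\<bar>" p 1] int \<open>1 < q\<close> \<open>q < p\<close> by simp
  have intq: "integrable M (\<lambda>x. \<bar>\<phi> x\<bar> powr q)"
    using integrable_powr_mono[of "\<lambda>x. \<bar>\<phi> x\<bar>" p q] int \<open>1 < q\<close> \<open>q < p\<close> by simp
  have gc: "c \<le> g x" for x
    by (simp add: g_def)
  have gK: "g x \<le> K" for x
    using \<open>0 < c\<close> \<open>c \<le> K\<close> enn2real_mono[of "min (ennreal K) (tree_maximal M T \<phi> x)" "ennreal K"]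
    by (simp add: g_def)
  have weak: "ennreal (l powr q) * emeasure M {x \<in> space M. l < g x}
      \<le> (\<integral>\<^sup>+x\<in>{x \<in> space M. l < g x}. ennreal (\<bar>\<phi> x\<bar> powr q) \<partial>M)" if "c \<le> l" for l
  proof (cases "l < K")
    case True
    have "l < g x \<longleftrightarrow> ennreal l < tree_maximal M T \<phi> x" for x
    proof -
      \<comment> \<open>\<open>enn2real\<close> sends infinity to 0, so the cut at \<open>K\<close>
        has to precede the conversion.\<close>
      let ?m = "min (ennreal K) (tree_maximal M T \<phi> x)"
      have "?m \<noteq> \<top>"
        using neq_top_trans[OF ennreal_neq_top min.cobounded1] .
      then have "ennreal (enn2real ?m) = ?m"
        by (simp add: less_top)
      then have "l < enn2real ?m \<longleftrightarrow> ennreal l < ?m"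
        using that \<open>0 < c\<close> ennreal_less_iff[of l "enn2real ?m"] by simp
      then show ?thesis
        using that \<open>0 < c\<close> True by (auto simp: g_def ennreal_less_iff)
    qed
    then show ?thesis
      using tree_maximal_weak_type[OF assms(1,2) meas int1 intq \<open>1 < q\<close>, of l] that \<open>0 < c\<close> by simp
  next
    case False
    then have "{x \<in> space M. l < g x} = {}"
      using gK by (auto simp: not_less intro: order_trans)
    then show ?thesis
      by (simp only: emeasure_empty mult_zero_right zero_le)
  qed
  have "g x powr p \<le> K powr p" for x
    using gc[of x] gK[of x] \<open>0 < c\<close> \<open>1 < q\<close> \<open>q < p\<close> by (intro powr_mono2) auto
  then have "integrable M (\<lambda>x. g x powr p)"
    by (intro integrable_const_bound[where B = "K powr p"] AE_I2) simp_all
  moreover have "(LINT x|M. g x powr p) \<le> (LINT x|M. \<bar>\<phi> x\<bar> powr p) * t powr p"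
    using weak_type_imp_moment_bound[OF assms(1) _ _ \<open>0 < c\<close> gc gK _ int \<open>q < p\<close> _ weak \<open>1 < t\<close> h] \<open>1 < q\<close>
    by simp
  ultimately show ?thesis
    by (simp add: nn_integral_eq_integral ennreal_leI)
qed

text \<open>Monotone convergence: the bound for the truncations does not depend on the truncation
  level.\<close>

lemma tree_maximal_moment_bound:
  assumes "prob_space M" "is_tree M T" and meas [measurable]: "\<phi> \<in> borel_measurable M"
    and int: "integrable M (\<lambda>x. \<bar>\<phi> x\<bar> powr p)"
    and "1 < q" "q < p" "0 < c" "1 < t"
    and h: "(LINT x|M. \<bar>\<phi> x\<bar> powr p) * h_fun p q t
      \<le> p * c powr (p - q) * (LINT x|M. \<bar>\<phi> x\<bar> powr q) - (p - q) * c powr p"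
  shows "(\<integral>\<^sup>+x. ennreal_powr (tree_maximal M T \<phi> x) p \<partial>M)
      \<le> ennreal ((LINT x|M. \<bar>\<phi> x\<bar> powr p) * t powr p)"
proof -
  note [measurable] = tree_maximal_measurable[OF assms(2)]
  \<comment> \<open>Levels of the form c + n satisfy \<open>c \<le> K\<close> for every n, including
    n = 0.\<close>
  define g where "g n x = max c (enn2real (min (ennreal (c + real n)) (tree_maximal M T \<phi> x)))" for n x
  have [measurable]: "g n \<in> borel_measurable M" for n
    unfolding g_def by measurable
  have "1 < p"
    using \<open>1 < q\<close> \<open>q < p\<close> by simp
  have "c \<le> g n x" for n x
    by (simp add: g_def)
  then have g0: "0 \<le> g n x" for n x
    using \<open>0 < c\<close> by (meson less_imp_le order_trans)
  have "g m x \<le> g n x" if "m \<le> n" for m n x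
    unfolding g_def using that
    by (intro max.mono enn2real_mono min.mono order_refl ennreal_leI)
       (auto simp: min_def less_top[symmetric] top_unique)
  then have mono: "incseq (\<lambda>n x. ennreal (g n x powr p))"
    using g0 \<open>1 < p\<close> by (auto simp: incseq_def le_fun_def intro!: ennreal_leI powr_mono2)
  have le: "ennreal_powr (tree_maximal M T \<phi> x) p \<le> (SUP n. ennreal (g n x powr p))" for x
  proof (cases "tree_maximal M T \<phi> x")
    case (real r)
    obtain n where "r \<le> real n"
      using real_arch_simple by blast
    then have "min (ennreal (c + real n)) (ennreal r) = ennreal r"
      using \<open>0 < c\<close> by (intro min_absorb2 ennreal_leI) simp
    then have "r \<le> g n x"
      using real by (simp add: g_def)
    then have "ennreal (r powr p) \<le> ennreal (g n x powr p)"
      using real \<open>1 < p\<close> by (intro ennreal_leI powr_mono2) auto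
    also have "\<dots> \<le> (SUP n. ennreal (g n x powr p))"
      by (rule SUP_upper) simp
    finally show ?thesis
      using real by (simp add: ennreal_powr_def)
  next
    case top
    \<comment> \<open>Where the maximal function is infinite the truncation equals c + n. For n >= 1
      this is at least 1, so its p-th power is at least c + n.\<close>
    have "of_nat n \<le> ennreal (g n x powr p)" for n
    proof (cases "n = 0")
      case False
      have "g n x = c + real n"
        using top \<open>0 < c\<close> by (simp add: g_def del: ennreal_plus)
      moreover have "(c + real n) powr 1 \<le> (c + real n) powr p"
        using False \<open>0 < c\<close> \<open>1 < p\<close> by (intro powr_mono) auto
      ultimately have "real n \<le> g n x powr p"
        using \<open>0 < c\<close> by simp
      then show ?thesis
        by (simp add: ennreal_leI flip: ennreal_of_nat_eq_real_of_nat)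
    qed simp
    then have "(SUP n. ennreal (g n x powr p)) = \<top>"
      by (intro ennreal_SUP_eq_top) auto
    then show ?thesis
      by (simp only: top_greatest)
  qed
  have "(\<integral>\<^sup>+x. ennreal_powr (tree_maximal M T \<phi> x) p \<partial>M)
      \<le> (\<integral>\<^sup>+x. (SUP n. ennreal (g n x powr p)) \<partial>M)"
    using le by (intro nn_integral_mono)
  also have "\<dots> = (SUP n. \<integral>\<^sup>+x. ennreal (g n x powr p) \<partial>M)"
    using mono by (intro nn_integral_monotone_convergence_SUP) measurable
  also have "\<dots> \<le> ennreal ((LINT x|M. \<bar>\<phi> x\<bar> powr p) * t powr p)"
    unfolding g_def using assms
    by (intro SUP_least tree_maximal_truncated_bound[where q = q]) simp_all
  finally show ?thesis .
qed

section \<open>The sharp bound: t is taken to be the value of \<open>h_inv\<close>\<close>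

theorem lemma4p2:
  fixes M :: "'a measure" and T :: "'a set set" and \<phi> :: "'a \<Rightarrow> real"
    and p q f A F :: real
  assumes "1 < q" and "q < p"
    and "prob_space M" and "non_atomic M"
    and "is_tree M T"
    and "\<phi> \<in> borel_measurable M" and "integrable M (\<lambda>x. \<bar>\<phi> x\<bar> powr p)"
    and "AE x in M. 0 \<le> \<phi> x"
    and "(LINT x|M. \<phi> x) = f" and "f > 0"
    and "(LINT x|M. \<phi> x powr q) = A"
    and "(LINT x|M. \<phi> x powr p) = F"
  shows "(\<integral>\<^sup>+ x. ennreal_powr (tree_maximal M T \<phi> x) p \<partial>M)
           \<le> ennreal (F * h_inv p q ((p * f powr (p - q) * A - (p - q) * f powr p) / F) powr p)"
proof -
  interpret prob_space M by fact
  note [measurable] = \<open>\<phi> \<in> borel_measurable M\<close>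
  have f: "(LINT x|M. \<bar>\<phi> x\<bar>) = f"
    unfolding assms(9)[symmetric] using assms(8) by (intro integral_cong_AE) auto
  have A: "(LINT x|M. \<bar>\<phi> x\<bar> powr q) = A"
    unfolding assms(11)[symmetric] using assms(8) by (intro integral_cong_AE) auto
  have F: "(LINT x|M. \<bar>\<phi> x\<bar> powr p) = F"
    unfolding assms(12)[symmetric] using assms(8) by (intro integral_cong_AE) auto
  \<comment> \<open>Young's inequality for |phi| and the constant f, integrated. The case r = 1
    gives f^p <= F and thus F > 0; the case r = q gives s <= q, so that \<open>h_inv\<close> is
    evaluated inside its domain.\<close>
  have Young: "p * f powr (p - r) * (LINT x|M. \<bar>\<phi> x\<bar> powr r) \<le> r * F + (p - r) * f powr p"
    if "0 < r" "r < p" for r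
  proof -
    have r: "integrable M (\<lambda>x. \<bar>\<phi> x\<bar> powr r)"
      using integrable_powr_mono[of "\<lambda>x. \<bar>\<phi> x\<bar>" p r] assms(7) that by simp
    have "(LINT x|M. p * f powr (p - r) * \<bar>\<phi> x\<bar> powr r)
        \<le> (LINT x|M. r * \<bar>\<phi> x\<bar> powr p + (p - r) * f powr p)"
    proof (rule integral_mono)
      show "p * f powr (p - r) * \<bar>\<phi> x\<bar> powr r \<le> r * \<bar>\<phi> x\<bar> powr p + (p - r) * f powr p" for x
        using Youngs_inequality_powr[of "\<bar>\<phi> x\<bar>" f r p] that \<open>0 < f\<close> by (simp add: mult_ac)
    qed (use r assms(7) in simp_all)
    then show ?thesis
      using r assms(7) by (simp add: F prob_space)
  qed
  have "p * (f powr (p - 1) * f) \<le> F + (p - 1) * f powr p"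
    using Young[of 1] assms(1,2) by (simp add: f mult.assoc)
  moreover have "f powr (p - 1) * f = f powr p"
    using \<open>0 < f\<close> by (simp add: powr_diff)
  ultimately have "p * f powr p \<le> F + (p - 1) * f powr p"
    by (simp only:)
  then have "f powr p \<le> F"
    by (simp add: algebra_simps)
  then have "0 < F"
    using \<open>0 < f\<close> by (smt (verit) powr_gt_zero)
  define s where "s = (p * f powr (p - q) * A - (p - q) * f powr p) / F"
  have "s \<le> q"
    using Young[of q] assms(1,2) \<open>0 < F\<close> by (simp add: s_def A field_simps)
  then have h_inv: "1 \<le> h_inv p q s" "h_fun p q (h_inv p q s) = s"
    using h_inv_correct[of q p s] assms(1,2) by simp_all
  \<comment> \<open>Multiplying \<open>h_fun p q t \<le> s\<close> by F > 0 gives the admissibility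
    condition with c = f.\<close>
  have bound: "(\<integral>\<^sup>+ x. ennreal_powr (tree_maximal M T \<phi> x) p \<partial>M) \<le> ennreal (F * t powr p)"
    if "1 < t" "h_fun p q t \<le> s" for t
  proof -
    have "F * h_fun p q t \<le> F * s"
      using that \<open>0 < F\<close> by (intro mult_left_mono) auto
    then show ?thesis
      using tree_maximal_moment_bound[OF assms(3,5,6,7,1,2) \<open>0 < f\<close> \<open>1 < t\<close>] \<open>0 < F\<close>
      by (simp add: F A s_def)
  qed
  show ?thesis
  proof (cases "h_inv p q s = 1")
    case True
    \<comment> \<open>Since \<open>q\<close> is an upper bound of \<open>h_fun p q\<close>, every \<open>t > 1\<close> is admissible in \<open>bound\<close>; let \<open>t\<close> decrease to 1.\<close>
    with h_inv have "s = q"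
      by (simp add: h_fun_def)
    then have "\<forall>\<^sub>F t in at_right 1.
        (\<integral>\<^sup>+ x. ennreal_powr (tree_maximal M T \<phi> x) p \<partial>M) \<le> ennreal (F * t powr p)"
      using bound h_fun_le[of q p] assms(1,2) by (intro eventually_at_rightI[of 1 2]) auto
    moreover have "((\<lambda>t. ennreal (F * t powr p)) \<longlongrightarrow> ennreal (F * 1 powr p)) (at_right 1)"
      by (intro tendsto_intros) auto
    ultimately have "(\<integral>\<^sup>+ x. ennreal_powr (tree_maximal M T \<phi> x) p \<partial>M) \<le> ennreal (F * 1 powr p)"
      by (intro tendsto_lowerbound) auto
    then show ?thesis
      using True by (simp add: s_def)
  next
    case False
    then show ?thesis
      using bound[of "h_inv p q s"] h_inv by (simp add: s_def)
  qed
qed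

end
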